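(* Let $(M,\mathbf T)$ be a triangulated oriented closed pseudo 3-manifold and let $k:E\to\mathbf S^1$ satisfy $\prod_{e\in E}k(e)=1$ and, for each vertex $v\in V$, $\prod_{e\in E}k(e)^{n(e,v)}=1$, where $n(e,v)\in\{0,1,2\}$ is the number of endpoints of $e$ equal to $v$. Let $p$ be a maximum point of the volume function $\mathbf V:SAS(\mathbf T,k)\to\mathbb R$. (a) If $p$ is a smooth point for $\mathbf V$, then there exists $z\in\mathbb C^{\Box}$ such that $z(q')(1-z(q))=1$ for all $q,q'\in\Box$ with $\omega(q,q')=1$, and $\prod_{q\in\Box}z(q)^{2i(q,e)}=k(e)^2$ for every $e\in E$. (b) If $p$ is a non-smooth point for $\mathbf V$, i.e. $p(q_0)=\pm1$ for some $q_0\in\Box$, then there exists a 2-quad-type solution $y$ to Haken's normal surface equation such that $y(q_0)\neq0$.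
   Context: Triangulations. Let $X$ be a disjoint union of finitely many oriented Euclidean tetrahedra, and identify the codimension-1 faces of $X$ in pairs by orientation-reversing affine homeomorphisms. The quotient $M$ is an oriented closed pseudo 3-manifold, and the images of the simplices of $X$ form its triangulation $\mathbf T$ (simplices need not be embedded in $M$). $V,E,F,T$ are the sets of vertices, edges, triangles and tetrahedra of $\mathbf T$. An edge $e\in E$ is regarded as an equivalence class of edges $e^*$ of the tetrahedra of $X$ (those identified to $e$). Normal disks. In a tetrahedron there are, up to normal isotopy, four normal triangles (one cutting off each vertex) and three normal quadrilaterals (one for each pair of opposite edges: the quadrilateral is disjoint from exactly these two edges). $\triangle$ and $\Box$ denote the sets of all normal isotopy classes of normal triangles and quadrilaterals in the tetrahedra of $\mathbf T$; $q\subset\sigma$ means that $q$ lies in the tetrahedron $\sigma$. For $q\in\Box$, $e\in E$, the index $i(q,e)\in\{0,1,2\}$ is the number of edges $e^*$ in the class $e$ that lie in the same tetrahedron (of $X$) as $q$ and are disjoint from $q$. Haken's normal surface equation. It is the linear system for $x\in\mathbb R^{\triangle}\times\mathbb R^{\Box}$ with one equation for each normal isotopy class of normal arcs $a$ in the triangles of $\mathbf T$ (an arc in a triangle joining two different edges). If $\sigma,\sigma'$ are the tetrahedra on the two sides of the triangle containing $a$, the equation is $x(t)+x(q)=x(t')+x(q')$, where $t,q\subset\sigma$ and $t',q'\subset\sigma'$ are the normal triangles and quadrilaterals having $a$ as an edge on the respective sides. (If $a$ cuts off vertex $v$ in a face of $\sigma$ with vertices $v,u,w$ and $y$ is the fourth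 vertex of $\sigma$, then $t$ is the triangle cutting off $v$ and $q$ is the quadrilateral separating $\{v,y\}$ from $\{u,w\}$.) The numbers $x(q)$, $q\in\Box$, are the quadrilateral coordinates of $x$. A 2-quad-type solution is a solution with exactly one or two non-zero quadrilateral coordinates. Orientation convention. For an oriented tetrahedron $\sigma$ with vertices $v_0,v_1,v_2,v_3$ ordered compatibly with the orientation, let $q_1,q_2,q_3$ be the quadrilaterals disjoint from the edges $\{v_0v_1,v_2v_3\}$, $\{v_0v_2,v_1v_3\}$, $\{v_0v_3,v_1v_2\}$. The cyclic order $q_1\to q_2\to q_3\to q_1$ depends only on the orientation. For $q,q'\in\Box$ we set $\omega(q,q')=1$ if $q,q'$ lie in the same tetrahedron and $q\to q'$ in this cyclic order. Angle structures and volume. Let $\mathbf S^1$ be the unit circle in $\mathbb C$. $SAS(\mathbf T,k)$ is the set of all $x:\Box\to\mathbf S^1$ such that $\prod_{q\subset\sigma}x(q)=-1$ for each $\sigma\in T$ and $\prod_{q\in\Box}x(q)^{i(q,e)}=k(e)$ for each $e\in E$. Let $\Lambda(x)=-\int_0^x\ln|2\sin u|\,du$ be the Lobachevsky function (continuous, of period $\pi$). The volume is $\mathbf V(x)=\sum_{q\in\Box}\Lambda(\arg x(q))$. A point $x$ is a smooth point for $\mathbf V$ if $x(q)\ne\pm1$ for all $q\in\Box$, and a non-smooth point otherwise. *)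

theory Defs
  imports "HOL-Analysis.Analysis" "HOL-Combinatorics.Permutations"
begin

text \<open>
  The four vertices of an oriented tetrahedron, listed compatibly with its orientation.
\<close>

datatype vert = V0 | V1 | V2 | V3

lemma UNIV_vert: "UNIV = {V0, V1, V2, V3}"
  by (auto intro: vert.exhaust)

instance vert :: finite
  by standard (simp add: UNIV_vert)

text \<open>
  The three normal quadrilaterals of a tetrahedron, in the cyclic order given by the
  orientation. Each is named after the pair of opposite edges it is disjoint from; it separates
  the end points of one of these edges from the end points of the other.
\<close>

datatype quad_type = Q01_23 | Q02_13 | Q03_12

lemma UNIV_quad_type: "UNIV = {Q01_23, Q02_13, Q03_12}"
  by (auto intro: quad_type.exhaust)

instance quad_type :: finite
  by standard (simp add: UNIV_quad_type)

fun disjoint_edges :: "quad_type \<Rightarrow> vert set set" where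
  "disjoint_edges Q01_23 = {{V0, V1}, {V2, V3}}"
| "disjoint_edges Q02_13 = {{V0, V2}, {V1, V3}}"
| "disjoint_edges Q03_12 = {{V0, V3}, {V1, V2}}"

fun next_quad :: "quad_type \<Rightarrow> quad_type" where
  "next_quad Q01_23 = Q02_13"
| "next_quad Q02_13 = Q03_12"
| "next_quad Q03_12 = Q01_23"

text \<open>
  The tetrahedra of the disjoint union \<open>X\<close> are the elements of a finite type \<open>'a\<close>. The pair
  \<open>(\<sigma>, i)\<close> stands for the vertex \<open>i\<close> of \<open>\<sigma>\<close>, for the face of \<open>\<sigma>\<close> opposite to it, or for the
  normal triangle in \<open>\<sigma>\<close> cutting it off, according to context; \<open>(\<sigma>, {u, w})\<close> stands for an edge
  of \<open>\<sigma>\<close>.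

  An affine homeomorphism between two faces is determined by its values on the three vertices.
  If \<open>G (\<sigma>, i) = (\<tau>, \<pi>)\<close>, then the face of \<open>\<sigma>\<close> opposite to \<open>i\<close> is glued to the face of \<open>\<tau>\<close>
  opposite to \<open>\<pi> i\<close>, each vertex \<open>j \<noteq> i\<close> of \<open>\<sigma>\<close> being sent to the vertex \<open>\<pi> j\<close> of \<open>\<tau>\<close>. Thus
  \<open>\<pi>\<close> is the vertex map of the gluing, extended by sending the remaining vertex to the remaining
  vertex.
\<close>

type_synonym 'a gluing = "'a \<times> vert \<Rightarrow> 'a \<times> (vert \<Rightarrow> vert)"
type_synonym 'a tet_vertex = "'a \<times> vert"
type_synonym 'a tet_edge = "'a \<times> vert set"
type_synonym 'a normal_triangle = "'a \<times> vert"
type_synonym 'a quad = "'a \<times> quad_type"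

text \<open>
  The faces carry the boundary orientations, so a gluing of faces reverses orientation iff the
  extended vertex permutation is odd (the identity glues two equally oriented copies of a
  tetrahedron along the same face preserving the boundary orientation). The last two conditions
  say that the faces are identified in pairs: \<open>G\<close> induces a fixed-point free involution on the
  faces, and the two gluing maps of a pair are mutually inverse.
\<close>

definition oriented_triangulation :: "'a gluing \<Rightarrow> bool" where
  "oriented_triangulation G \<longleftrightarrow>
    (\<forall>\<sigma> i \<tau> \<pi>. G (\<sigma>, i) = (\<tau>, \<pi>) \<longrightarrow>
      bij \<pi> \<and> \<not> evenperm \<pi> \<and> (\<tau>, \<pi> i) \<noteq> (\<sigma>, i) \<and> G (\<tau>, \<pi> i) = (\<sigma>, inv \<pi>))"

definition vertex_glued :: "'a gluing \<Rightarrow> 'a tet_vertex \<Rightarrow> 'a tet_vertex \<Rightarrow> bool" where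
  "vertex_glued G a b \<longleftrightarrow>
    (\<exists>\<sigma> i \<tau> \<pi> u. G (\<sigma>, i) = (\<tau>, \<pi>) \<and> u \<noteq> i \<and> a = (\<sigma>, u) \<and> b = (\<tau>, \<pi> u))"

definition vertices :: "'a gluing \<Rightarrow> 'a tet_vertex set set" where
  "vertices G = UNIV // {(a, b). equivclp (vertex_glued G) a b}"

definition edge_glued :: "'a gluing \<Rightarrow> 'a tet_edge \<Rightarrow> 'a tet_edge \<Rightarrow> bool" where
  "edge_glued G a b \<longleftrightarrow>
    (\<exists>\<sigma> i \<tau> \<pi> u w. G (\<sigma>, i) = (\<tau>, \<pi>) \<and> u \<noteq> i \<and> w \<noteq> i \<and> u \<noteq> w \<and>
      a = (\<sigma>, {u, w}) \<and> b = (\<tau>, {\<pi> u, \<pi> w}))"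

definition tet_edges :: "'a tet_edge set" where
  "tet_edges = {(\<sigma>, {u, w}) | \<sigma> u w. u \<noteq> w}"

definition edges :: "'a gluing \<Rightarrow> 'a tet_edge set set" where
  "edges G = tet_edges // {(a, b). equivclp (edge_glued G) a b}"

text \<open>
  The number \<open>n(e,v)\<close> of end points of \<open>e\<close> equal to \<open>v\<close>, counted on a representative of \<open>e\<close>. The
  count is independent of the representative, because glued edges have glued end points.
\<close>

definition endpoint_count :: "'a tet_edge set \<Rightarrow> 'a tet_vertex set \<Rightarrow> nat" where
  "endpoint_count e v = (let (\<sigma>, s) = (SOME a. a \<in> e) in card {u \<in> s. (\<sigma>, u) \<in> v})"

definition quad_index :: "'a quad \<Rightarrow> 'a tet_edge set \<Rightarrow> nat" where
  "quad_index q e = card {a \<in> e. fst a = fst q \<and> snd a \<in> disjoint_edges (snd q)}"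

text \<open>The relation \<open>\<omega>(q,q') = 1\<close>.\<close>

definition quad_arrow :: "'a quad \<Rightarrow> 'a quad \<Rightarrow> bool" where
  "quad_arrow q q' \<longleftrightarrow> fst q' = fst q \<and> snd q' = next_quad (snd q)"

text \<open>
  The normal arc in the face of \<open>\<sigma>\<close> opposite to \<open>i\<close> cutting off the vertex \<open>v\<close> is an edge of the
  normal triangle at \<open>v\<close> and of the quadrilateral disjoint from the edge \<open>{v, i}\<close>. Each arc of the
  triangulation is listed twice, once from either side, which gives the same equation.
\<close>

definition haken_solution ::
    "'a gluing \<Rightarrow> ('a normal_triangle \<Rightarrow> real) \<times> ('a quad \<Rightarrow> real) \<Rightarrow> bool" where
  "haken_solution G y \<longleftrightarrow>
    (\<forall>\<sigma> i v \<tau> \<pi> q q'. G (\<sigma>, i) = (\<tau>, \<pi>) \<and> v \<noteq> i \<and>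
        {v, i} \<in> disjoint_edges q \<and> {\<pi> v, \<pi> i} \<in> disjoint_edges q' \<longrightarrow>
      fst y (\<sigma>, v) + snd y (\<sigma>, q) = fst y (\<tau>, \<pi> v) + snd y (\<tau>, q'))"

definition two_quad_type_solution ::
    "'a gluing \<Rightarrow> ('a normal_triangle \<Rightarrow> real) \<times> ('a quad \<Rightarrow> real) \<Rightarrow> bool" where
  "two_quad_type_solution G y \<longleftrightarrow>
    haken_solution G y \<and> card {q. snd y q \<noteq> 0} \<in> {1, 2}"

definition SAS :: "'a::finite gluing \<Rightarrow> ('a tet_edge set \<Rightarrow> complex) \<Rightarrow> ('a quad \<Rightarrow> complex) set"
  where
  "SAS G k = {x. (\<forall>q. x q \<in> sphere 0 1) \<and>
    (\<forall>\<sigma>. (\<Prod>j\<in>UNIV. x (\<sigma>, j)) = -1) \<and>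
    (\<forall>e\<in>edges G. (\<Prod>q\<in>UNIV. x q ^ quad_index q e) = k e)}"

definition lobachevsky :: "real \<Rightarrow> real" where
  "lobachevsky x = - (LBINT u=0..x. ln \<bar>2 * sin u\<bar>)"

text \<open>The choice of the branch of the argument is irrelevant, as \<open>lobachevsky\<close> has period \<open>pi\<close>.\<close>

definition angle_volume :: "('a::finite quad \<Rightarrow> complex) \<Rightarrow> real" where
  "angle_volume x = (\<Sum>q\<in>UNIV. lobachevsky (Arg (x q)))"

definition smooth_point :: "('a quad \<Rightarrow> complex) \<Rightarrow> bool" where
  "smooth_point x \<longleftrightarrow> (\<forall>q. x q \<noteq> 1 \<and> x q \<noteq> -1)"

end

theory Submission
  imports Defs "HOL-Real_Asymp.Real_Asymp"
begin

text \<open>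
  Let \<open>W\<close> be the space of tangent directions \<open>u\<close> of \<open>SAS G k\<close> (\<open>deformations\<close>) and \<open>a = Arg p\<close>. Because
  \<open>\<Lambda>'(x) = - ln |2 sin x|\<close> away from the multiples of \<open>\<pi>\<close> and \<open>\<Lambda>(x) = - x ln |x| + (1 - ln 2) x + o(x)\<close>
  at \<open>0\<close>, comparing the volumes of \<open>p\<close> and \<open>p cis(t u)\<close> for small \<open>t\<close> gives the first order condition
  (\<open>critical_point\<close>): for every \<open>u\<close> in \<open>W\<close>, the sum of \<open>u(q) ln |u(q)|\<close> over the quadrilaterals with
  \<open>p(q) = \<plusminus>1\<close> plus the sum of \<open>u(q) ln |2 sin a(q)|\<close> over the others is \<open>0\<close>.

  If \<open>p\<close> is smooth, let \<open>z(q) = sin a(q') / sin a(q'') p(q)\<close> for \<open>q \<rightarrow> q' \<rightarrow> q''\<close>, the shape parameter of a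
  triangle with the angles \<open>a\<close>. The relation \<open>z(q') (1 - z(q)) = 1\<close> is trigonometry. The edge equation for
  \<open>e\<close> reduces to its modulus, which is the first order condition for \<open>u(q) = i(q'',e) - i(q',e)\<close>. That
  this \<open>u\<close> lies in \<open>W\<close> is the isotropy of the index vectors for the form \<open>\<omega>\<close>
  (\<open>quad_index_symplectic\<close>), which comes from the gluing maps reversing the orientation of the faces.

  If \<open>p(q\<^sub>0) = \<plusminus>1\<close>, the first order condition is a relation between functions \<open>u(q) ln |u(q)|\<close> modulo
  linear functions on \<open>W\<close>. As \<open>s ln |s|\<close> is not differentiable at \<open>0\<close>, this forces \<open>u(q\<^sub>0)\<close> to vanish on
  \<open>W\<close>, or to be proportional to some other \<open>u(q\<^sub>1)\<close> with \<open>p(q\<^sub>1) = \<plusminus>1\<close> (\<open>x_ln_abs_dependence\<close>). In both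
  cases there is a vector \<open>x\<close> orthogonal to \<open>W\<close> with \<open>x(q\<^sub>0) \<noteq> 0\<close> and one or two nonzero coordinates.
  Finally, every vector orthogonal to \<open>W\<close> is the vector of quadrilateral coordinates of a solution to
  Haken's equation, whose triangle coordinates can be written down explicitly
  (\<open>haken_solution_of_orthogonal\<close>).
\<close>

section \<open>The Lobachevsky function\<close>

lemma has_real_derivative_x_ln_abs:
  fixes x :: real
  assumes "x \<noteq> 0"
  shows "((\<lambda>x. x * ln \<bar>x\<bar>) has_real_derivative ln \<bar>x\<bar> + 1) (at x)"
proof -
  have ln_abs: "ln \<bar>y\<bar> = ln (y\<^sup>2) / 2" for y :: real
    using ln_realpow[of "\<bar>y\<bar>" 2] by (cases "y = 0") simp_all
  show ?thesis
    unfolding ln_abs using assms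
    by (auto intro!: derivative_eq_intros simp: power2_eq_square zero_less_mult_iff field_simps)
qed

lemma half_le_sin:
  fixes x :: real
  assumes "0 \<le> x" "x \<le> pi / 2"
  shows "x / 2 \<le> sin x"
proof -
  have "x * cos x \<le> sin x" if "0 \<le> x" "x \<le> pi" for x :: real
  proof -
    have "(\<lambda>x. sin x - x * cos x) 0 \<le> (\<lambda>x. sin x - x * cos x) x"
    proof (rule DERIV_nonneg_imp_nondecreasing[OF that(1)])
      fix y :: real assume "0 \<le> y" "y \<le> x"
      then have "0 \<le> y * sin y" using that by (simp add: sin_ge_zero)
      moreover have "((\<lambda>x. sin x - x * cos x) has_real_derivative y * sin y) (at y)"
        by (auto intro!: derivative_eq_intros)
      ultimately show "\<exists>d. ((\<lambda>x. sin x - x * cos x) has_real_derivative d) (at y) \<and> 0 \<le> d" by blast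
    qed
    then show ?thesis by simp
  qed
  from this[of "x/2"] have 1: "x / 2 * cos (x/2) \<le> sin (x/2)" using assms by auto
  have c: "0 \<le> cos (x/2)" using assms by (intro cos_ge_zero) auto
  have "x / 2 \<le> x * (1 + cos x) / 2"
    using assms by (simp add: field_simps cos_ge_zero)
  also have "\<dots> = 2 * (x / 2 * cos (x/2)) * cos (x/2)"
    using cos_double_cos[of "x/2"] by (simp add: power2_eq_square field_simps)
  also have "\<dots> \<le> 2 * sin (x/2) * cos (x/2)"
    using 1 c by (intro mult_right_mono) auto
  also have "\<dots> = sin x" using sin_double[of "x/2"] by simp
  finally show ?thesis .
qed

text \<open>
  Near each end of the interval the sine is at least half the distance to that end, so the
  integrand is dominated by a sum of two logarithms with an explicit primitive.
\<close>

lemma log_sine_integrable: "set_integrable lborel {0..pi} (\<lambda>u. ln \<bar>2 * sin u\<bar>)"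
proof -
  let ?g = "\<lambda>u::real. 2 * ln 2 + 2 * ln pi - ln u - ln (pi - u)"
  let ?G = "\<lambda>u::real. (2 * ln 2 + 2 * ln pi + 2) * u - u * ln u + (pi - u) * ln (pi - u)"
  have bound: "0 \<le> ?g u \<and> \<bar>ln \<bar>2 * sin u\<bar>\<bar> \<le> ?g u" if "0 < u" "u < pi" for u
  proof -
    have s: "0 < sin u" using that by (simp add: sin_gt_zero)
    have l: "ln u \<le> ln pi" "ln (pi - u) \<le> ln pi" using that by auto
    have up: "ln (2 * sin u) \<le> ln 2" using s by (subst ln_le_cancel_iff) auto
    have l2: "(0::real) \<le> ln 2" by simp
    have "ln u - ln 2 \<le> ln (sin u) \<or> ln (pi - u) - ln 2 \<le> ln (sin u)"
    proof (cases "u \<le> pi/2")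
      case True
      then have "ln (u/2) \<le> ln (sin u)" using half_le_sin[of u] that s by (subst ln_le_cancel_iff) auto
      then show ?thesis using that by (simp add: ln_div)
    next
      case False
      then have "ln ((pi-u)/2) \<le> ln (sin u)" using half_le_sin[of "pi-u"] that s by (subst ln_le_cancel_iff) auto
      then show ?thesis using that by (simp add: ln_div)
    qed
    moreover have "ln (2 * sin u) = ln 2 + ln (sin u)" using s by (simp add: ln_mult)
    moreover have "0 \<le> ln pi" using pi_ge_two by simp
    moreover have "ln \<bar>2 * sin u\<bar> = ln 2 + ln (sin u)" using s by (simp add: ln_mult)
    ultimately show ?thesis using up l l2 unfolding abs_le_iff by - (intro conjI; linarith)
  qed
  have d: "DERIV ?G x :> ?g x" if "0 < x" "x < pi" for x
  proof -
    have "((\<lambda>u. u * ln u) has_real_derivative ln x + 1) (at x)"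
      using that by (auto intro!: derivative_eq_intros)
    moreover have "((\<lambda>u. (pi - u) * ln (pi - u)) has_real_derivative - ln (pi - x) - 1) (at x)"
      using that by (auto intro!: derivative_eq_intros)
    ultimately show ?thesis
      using that by (auto intro!: derivative_eq_intros)
  qed
  have 0: "((\<lambda>x::real. x * ln x) \<longlongrightarrow> 0) (at_right 0)" by real_asymp
  have "filterlim (\<lambda>u::real. pi - u) (at_right 0) (at_left pi)"
    unfolding filterlim_at
    by (auto intro!: tendsto_eq_intros eventually_at_leftI[of 0])
  from filterlim_compose[OF 0 this]
  have pi: "((\<lambda>u::real. (pi - u) * ln (pi - u)) \<longlongrightarrow> 0) (at_left pi)" .
  have "(?G \<longlongrightarrow> pi * ln pi) (at_right 0)"
    by (rule tendsto_eq_intros 0 refl | simp)+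
  moreover have "(?G \<longlongrightarrow> (2 * ln 2 + 2 * ln pi + 2) * pi - pi * ln pi) (at_left pi)"
    by (rule tendsto_eq_intros pi refl | simp)+
  ultimately have "set_integrable lborel (einterval 0 (ereal pi)) ?g"
    using bound d
    by (intro interval_integral_FTC_nonneg(1)[where F = ?G])
      (auto simp: ereal_tendsto_simps zero_ereal_def less_imp_le intro!: continuous_intros)
  then have g: "set_integrable lborel {0<..<pi} ?g"
    by (simp add: zero_ereal_def)
  have "set_integrable lborel {0<..<pi} (\<lambda>u. ln \<bar>2 * sin u\<bar>)"
    by (rule set_integrable_bound[OF g])
      (use bound in \<open>auto simp: set_borel_measurable_def\<close>)
  also have "?this \<longleftrightarrow> ?thesis"
    by (rule set_integrable_discrete_difference[where X="{0, pi}"]) auto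
  finally show ?thesis .
qed

lemma lobachevsky_minus: "lobachevsky (- x) = - lobachevsky x"
proof -
  have "(LBINT u=0..ereal (-x). ln \<bar>2 * sin u\<bar>) = (LBINT u=ereal x..0. ln \<bar>2 * sin u\<bar>)"
    by (subst interval_integral_reflect) simp
  then show ?thesis
    by (simp add: lobachevsky_def interval_integral_endpoints_reverse[of "ereal x" 0])
qed

lemma lobachevsky_0 [simp]: "lobachevsky 0 = 0"
  using lobachevsky_minus[of 0] by simp

lemma lobachevsky_eq_integral:
  assumes "0 \<le> x" "x \<le> pi"
  shows "lobachevsky x = - integral {0..x} (\<lambda>u. ln \<bar>2 * sin u\<bar>)"
proof -
  have "set_integrable lborel {0..x} (\<lambda>u. ln \<bar>2 * sin u\<bar>)"
    using assms by (intro set_integrable_subset[OF log_sine_integrable]) auto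
  then show ?thesis
    using interval_integral_eq_integral[of 0 x] assms
    by (simp add: lobachevsky_def zero_ereal_def)
qed

lemma log_sine_integrable_on: "(\<lambda>u. ln \<bar>2 * sin u\<bar>) integrable_on {0..pi}"
  using set_borel_integral_eq_integral(1)[OF log_sine_integrable] .

lemma continuous_on_lobachevsky: "continuous_on {0..pi} lobachevsky"
proof -
  have "continuous_on {0..pi} (\<lambda>x. - integral {0..x} (\<lambda>u. ln \<bar>2 * sin u\<bar>))"
    by (intro continuous_on_minus indefinite_integral_continuous_1 log_sine_integrable_on)
  then show ?thesis
    by (rule continuous_on_eq) (simp add: lobachevsky_eq_integral)
qed

lemma has_field_derivative_lobachevsky_pos:
  assumes "0 < x" "x < pi"
  shows "(lobachevsky has_real_derivative - ln \<bar>2 * sin x\<bar>) (at x)"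
proof -
  have "sin x > 0" using assms by (simp add: sin_gt_zero)
  then have "continuous (at x within {0..pi} - {}) (\<lambda>u. ln \<bar>2 * sin u\<bar>)"
    by (intro continuous_intros) auto
  then have "((\<lambda>u. integral {0..u} (\<lambda>u. ln \<bar>2 * sin u\<bar>)) has_vector_derivative ln \<bar>2 * sin x\<bar>)
      (at x within {0..pi} - {})"
    using assms by (intro integral_has_vector_derivative_continuous_at log_sine_integrable_on) auto
  then have "((\<lambda>u. integral {0..u} (\<lambda>u. ln \<bar>2 * sin u\<bar>)) has_real_derivative ln \<bar>2 * sin x\<bar>)
      (at x within {0<..<pi})"
    unfolding has_real_derivative_iff_has_vector_derivative
    by (rule has_vector_derivative_within_subset) auto
  then have "((\<lambda>u. - integral {0..u} (\<lambda>u. ln \<bar>2 * sin u\<bar>)) has_real_derivative - ln \<bar>2 * sin x\<bar>)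
      (at x within {0<..<pi})"
    by (rule DERIV_minus)
  then have "(lobachevsky has_real_derivative - ln \<bar>2 * sin x\<bar>) (at x within {0<..<pi})"
    by (rule has_field_derivative_transform_within[OF _ zero_less_one])
      (use assms in \<open>auto simp: lobachevsky_eq_integral\<close>)
  then show ?thesis
    using assms by (simp add: at_within_open[of _ "{0<..<pi}"])
qed

lemma has_field_derivative_lobachevsky:
  assumes "- pi < x" "x < pi" "x \<noteq> 0"
  shows "(lobachevsky has_real_derivative - ln \<bar>2 * sin x\<bar>) (at x)"
proof (cases "0 < x")
  case True
  then show ?thesis using assms by (simp add: has_field_derivative_lobachevsky_pos)
next
  case False
  have "((\<lambda>x. - lobachevsky (- x)) has_real_derivative - (- ln \<bar>2 * sin (- x)\<bar> * (- 1))) (at x)"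
    using assms False
    by (intro DERIV_minus DERIV_chain2[OF has_field_derivative_lobachevsky_pos])
       (auto intro!: derivative_eq_intros)
  then show ?thesis by (simp add: lobachevsky_minus)
qed

lemma lobachevsky_reflect:
  assumes "0 \<le> x" "x \<le> pi"
  shows "lobachevsky (pi - x) + lobachevsky x = lobachevsky pi"
proof (cases "x = 0 \<or> x = pi")
  case False
  then have "0 < x" "x < pi" using assms by auto
  let ?f = "\<lambda>x. lobachevsky (pi - x) + lobachevsky x"
  have "?f x = ?f 0"
  proof (rule DERIV_isconst2[of 0 x])
    show "continuous_on {0..x} ?f"
      using assms
      by (auto intro!: continuous_intros continuous_on_compose2[OF continuous_on_lobachevsky]
            continuous_on_subset[OF continuous_on_lobachevsky])
    show "DERIV ?f y :> 0" if "0 < y" "y < x" for y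
    proof -
      have "DERIV ?f y :> - ln \<bar>2 * sin (pi - y)\<bar> * (- 1) + - ln \<bar>2 * sin y\<bar>"
        using that assms
        by (intro DERIV_add DERIV_chain2[OF has_field_derivative_lobachevsky_pos]
             has_field_derivative_lobachevsky_pos)
          (auto intro!: derivative_eq_intros)
      then show ?thesis by simp
    qed
  qed (use \<open>0 < x\<close> in auto)
  then show ?thesis by simp
qed auto

text \<open>
  With the duplication formula \<open>\<Lambda>(2x) = 2\<Lambda>(x) - 2\<Lambda>(\<pi>/2 - x)\<close> up to a constant,
  \<open>\<Lambda>(\<pi>) = 4\<Lambda>(\<pi>/2)\<close>, while the reflection formula gives \<open>\<Lambda>(\<pi>) = 2\<Lambda>(\<pi>/2)\<close>.
\<close>

lemma lobachevsky_pi [simp]: "lobachevsky pi = 0"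
proof -
  let ?f = "\<lambda>x. lobachevsky (2 * x) - 2 * lobachevsky x + 2 * lobachevsky (pi / 2 - x)"
  have "?f (pi / 2) = ?f 0"
  proof (rule DERIV_isconst2[of 0 "pi / 2"])
    show "continuous_on {0..pi / 2} ?f"
      by (auto intro!: continuous_intros continuous_on_compose2[OF continuous_on_lobachevsky]
            continuous_on_subset[OF continuous_on_lobachevsky])
    show "DERIV ?f y :> 0" if "0 < y" "y < pi / 2" for y
    proof -
      have "DERIV ?f y :> - ln \<bar>2 * sin (2 * y)\<bar> * 2 - 2 * (- ln \<bar>2 * sin y\<bar>)
          + 2 * (- ln \<bar>2 * sin (pi / 2 - y)\<bar> * (- 1))"
        using that
        by (intro DERIV_add DERIV_diff DERIV_cmult has_field_derivative_lobachevsky_pos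
              DERIV_chain2[OF has_field_derivative_lobachevsky_pos])
          (auto intro!: derivative_eq_intros)
      moreover have "sin y > 0" "cos y > 0" using that by (auto simp: sin_gt_zero cos_gt_zero)
      then have "ln \<bar>2 * sin (2 * y)\<bar> = ln \<bar>2 * sin y\<bar> + ln \<bar>2 * sin (pi / 2 - y)\<bar>"
        using ln_mult[of 2 2] by (simp add: sin_double sin_diff abs_mult ln_mult)
      ultimately show ?thesis by simp
    qed
  qed auto
  then have "lobachevsky pi = 4 * lobachevsky (pi / 2)" by simp
  moreover have "2 * lobachevsky (pi / 2) = lobachevsky pi"
    using lobachevsky_reflect[of "pi / 2"] by simp
  ultimately show ?thesis by simp
qed

lemma isCont_lobachevsky_0: "isCont lobachevsky 0"
proof -
  have "(lobachevsky \<longlongrightarrow> lobachevsky 0) (at 0 within {0..pi})"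
    using continuous_on_lobachevsky by (auto simp: continuous_on_def simp del: lobachevsky_0)
  then have r: "(lobachevsky \<longlongrightarrow> 0) (at_right 0)"
    by (simp add: at_within_Icc_at_right)
  then have "((\<lambda>x. - lobachevsky (- x)) \<longlongrightarrow> - 0) (at_left 0)"
    unfolding filterlim_at_left_to_right by (intro tendsto_minus) simp
  then have "(lobachevsky \<longlongrightarrow> 0) (at_left 0)"
    by (simp add: lobachevsky_minus)
  with r show ?thesis
    by (simp add: isCont_def filterlim_split_at)
qed

text \<open>
  The expansion \<open>\<Lambda>(x) = - x ln |x| + (1 - ln 2) x + o(x)\<close>, by l'Hospital's rule.
\<close>

lemma lobachevsky_asymp_0:
  "((\<lambda>x. lobachevsky x / x + ln \<bar>x\<bar>) \<longlongrightarrow> 1 - ln 2) (at 0)"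
proof -
  have 0: "((\<lambda>x::real. x * ln \<bar>x\<bar>) \<longlongrightarrow> 0) (at 0)"
    unfolding filterlim_at_split by (intro conjI; real_asymp)
  have "((\<lambda>x. (lobachevsky x + x * ln \<bar>x\<bar>) / x) \<longlongrightarrow> 1 - ln 2) (at 0)"
  proof (rule lhopital)
    show "((\<lambda>x. lobachevsky x + x * ln \<bar>x\<bar>) \<longlongrightarrow> 0) (at 0)"
      using tendsto_add[OF isCont_lobachevsky_0[unfolded isCont_def] 0] by simp
    have "((\<lambda>x::real. - ln \<bar>2 * sin x\<bar> + (ln \<bar>x\<bar> + 1)) \<longlongrightarrow> 1 - ln 2) (at 0)"
      unfolding filterlim_at_split by (intro conjI; real_asymp)
    then show "((\<lambda>x::real. (- ln \<bar>2 * sin x\<bar> + (ln \<bar>x\<bar> + 1)) / 1) \<longlongrightarrow> 1 - ln 2) (at 0)"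
      by simp
    have "((\<lambda>x. lobachevsky x + x * ln \<bar>x\<bar>) has_real_derivative - ln \<bar>2 * sin x\<bar> + (ln \<bar>x\<bar> + 1)) (at x)"
      if "x \<in> {-pi<..<pi}" "x \<noteq> 0" for x
    proof (rule DERIV_add)
      show "(lobachevsky has_real_derivative - ln \<bar>2 * sin x\<bar>) (at x)"
        using that by (intro has_field_derivative_lobachevsky) auto
      show "((\<lambda>x. x * ln \<bar>x\<bar>) has_real_derivative ln \<bar>x\<bar> + 1) (at x)"
        using that by (intro has_real_derivative_x_ln_abs)
    qed
    then show "\<forall>\<^sub>F x in at 0. ((\<lambda>x. lobachevsky x + x * ln \<bar>x\<bar>) has_real_derivative
        - ln \<bar>2 * sin x\<bar> + (ln \<bar>x\<bar> + 1)) (at x)"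
      by (intro eventually_at_in_open[of "{-pi<..<pi}", THEN eventually_mono]) auto
  qed (auto simp: eventually_at_filter intro!: derivative_eq_intros)
  then show ?thesis
    by (rule Lim_transform_eventually) (auto simp: eventually_at_filter add_divide_distrib)
qed

section \<open>Linear dependence detected by x ln |x|\<close>

lemma exists_nonvanishing_coordinates:
  fixes K :: "(real ^ 'n) set"
  assumes "subspace K" "finite N" "\<forall>i\<in>N. \<exists>v\<in>K. v $ i \<noteq> 0"
  shows "\<exists>v\<in>K. \<forall>i\<in>N. v $ i \<noteq> 0"
  using assms(2,3)
proof (induction N rule: finite_induct)
  case empty
  then show ?case using subspace_0[OF assms(1)] by blast
next
  case (insert j N)
  then obtain v w where v: "v \<in> K" "\<forall>i\<in>N. v $ i \<noteq> 0" and w: "w \<in> K" "w $ j \<noteq> 0" by auto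
  \<comment> \<open>the values of \<open>t\<close> for which a coordinate of \<open>v + t w\<close> could vanish\<close>
  define B where "B = (\<lambda>i. - (v $ i) / w $ i) ` insert j N"
  have "finite B" using insert.hyps by (simp add: B_def)
  then obtain t where t: "t \<notin> B"
    using ex_new_if_finite[OF infinite_UNIV_char_0] by blast
  have "(v + t *\<^sub>R w) $ i \<noteq> 0" if "i \<in> insert j N" for i
  proof (cases "w $ i = 0")
    case True
    then show ?thesis using that v w by auto
  next
    case False
    then have "t \<noteq> - (v $ i) / w $ i" using that t by (auto simp: B_def)
    then show ?thesis using False by (auto simp: field_simps add_eq_0_iff)
  qed
  moreover have "v + t *\<^sub>R w \<in> K"
    using v w assms(1) by (simp add: subspace_add subspace_scale)
  ultimately show ?case by blast
qed

lemma x_ln_abs_not_differentiable_0: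
  "\<not> ((\<lambda>s::real. s * ln \<bar>s\<bar>) has_real_derivative D) (at 0)"
proof
  assume "((\<lambda>s::real. s * ln \<bar>s\<bar>) has_real_derivative D) (at 0)"
  then have "((\<lambda>s::real. s * ln \<bar>s\<bar> / s) \<longlongrightarrow> D) (at 0)"
    by (simp add: DERIV_def)
  then have "((\<lambda>s::real. ln \<bar>s\<bar>) \<longlongrightarrow> D) (at 0)"
    by (rule Lim_transform_eventually) (auto simp: eventually_at_filter)
  then have "((\<lambda>s::real. ln \<bar>s\<bar>) \<longlongrightarrow> D) (at_right 0)"
    by (simp add: filterlim_at_split)
  then have "((\<lambda>s::real. ln s) \<longlongrightarrow> D) (at_right 0)"
    by (rule Lim_transform_eventually) (auto simp: eventually_at_filter)
  moreover have "filterlim (\<lambda>s::real. ln s) at_infinity (at_right 0)"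
    using ln_at_0 by (simp add: filterlim_at_bot_imp_at_infinity)
  ultimately show False
    using not_tendsto_and_filterlim_at_infinity trivial_limit_at_right_real by blast
qed

text \<open>
  If the functions \<open>u\<^sub>i ln |u\<^sub>i|\<close> add up to a linear function on a subspace \<open>W\<close>, then each of the
  coordinates \<open>u\<^sub>q\<close> involved vanishes on \<open>W\<close> or is proportional on \<open>W\<close> to another one of them.
  Otherwise there is a point of \<open>W\<close> where \<open>u\<^sub>q\<close> is zero and no other coordinate in the sum is zero,
  except those vanishing on all of \<open>W\<close>; moving from this point along a line on which \<open>u\<^sub>q\<close> varies,
  all summands but one are differentiable. The dependence is expressed by a vector orthogonal to
  \<open>W\<close> with one or two nonzero coordinates.
\<close>

lemma x_ln_abs_dependence:
  fixes W :: "(real ^ 'n) set"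
  assumes W: "subspace W"
    and rel: "\<forall>u\<in>W. (\<Sum>i\<in>N. u $ i * ln \<bar>u $ i\<bar>) + c \<bullet> u = 0"
    and q: "q \<in> N"
  shows "\<exists>x. x \<in> (W\<^sup>\<bottom>) \<and> x $ q \<noteq> 0 \<and> card {i. x $ i \<noteq> 0} \<in> {1, 2}"
proof (cases "\<forall>u\<in>W. u $ q = 0")
  case True
  have "axis q (1::real) \<in> (W\<^sup>\<bottom>)"
    using True by (auto simp: orthogonal_comp_def orthogonal_def inner_axis)
  moreover have "{i. axis q (1::real) $ i \<noteq> 0} = {q}" by (auto simp: axis_def)
  ultimately show ?thesis by (intro exI[of _ "axis q 1"]) auto
next
  case False
  then obtain w' where "w' \<in> W" "w' $ q \<noteq> 0" by blast
  define w where "w = (1 / w' $ q) *\<^sub>R w'"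
  have w: "w \<in> W" "w $ q = 1"
    using \<open>w' \<in> W\<close> \<open>w' $ q \<noteq> 0\<close> W by (auto simp: w_def subspace_scale)
  have "\<exists>r\<in>N. r \<noteq> q \<and> (\<exists>a. a \<noteq> 0 \<and> (\<forall>u\<in>W. u $ r = a * u $ q))"
  proof (rule ccontr)
    assume no: "\<not> ?thesis"
    define K where "K = {u \<in> W. u $ q = 0}"
    have K: "subspace K"
      using W by (auto simp: K_def subspace_def)
    define N' where "N' = {i \<in> N - {q}. \<exists>u\<in>W. u $ i \<noteq> 0}"
    have "\<exists>v\<in>K. v $ i \<noteq> 0" if i: "i \<in> N'" for i
    proof (rule ccontr)
      assume *: "\<not> ?thesis"
      have proportional: "u $ i = w $ i * u $ q" if "u \<in> W" for u
      proof -
        have "u - (u $ q) *\<^sub>R w \<in> K"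
          using that w W by (auto simp: K_def subspace_diff subspace_scale)
        then have "(u - (u $ q) *\<^sub>R w) $ i = 0" using * by blast
        then show ?thesis by simp
      qed
      then have "w $ i \<noteq> 0" using i by (auto simp: N'_def)
      then show False using no proportional i by (auto simp: N'_def)
    qed
    then obtain v where v: "v \<in> K" "\<forall>i\<in>N'. v $ i \<noteq> 0"
      using exists_nonvanishing_coordinates[OF K, of N'] by auto
    let ?l = "\<lambda>s i. (v + s *\<^sub>R w) $ i"
    have lW: "v + s *\<^sub>R w \<in> W" for s
      using v w W by (auto simp: K_def subspace_add subspace_scale)
    have diff: "(\<lambda>s. ?l s i * ln \<bar>?l s i\<bar>) field_differentiable (at 0)" if "i \<in> N - {q}" for i
    proof (cases "i \<in> N'")
      case True
      then have "v $ i \<noteq> 0" using v by blast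
      then have "((\<lambda>s. ?l s i * ln \<bar>?l s i\<bar>) has_real_derivative (ln \<bar>?l 0 i\<bar> + 1) * w $ i) (at 0)"
        by (intro DERIV_chain2[OF has_real_derivative_x_ln_abs]) (auto intro!: derivative_eq_intros)
      then show ?thesis unfolding field_differentiable_def by blast
    next
      case False
      then have "?l s i = 0" for s using lW[of s] that by (auto simp: N'_def)
      then show ?thesis by simp
    qed
    have "(\<lambda>s. \<Sum>i\<in>N-{q}. ?l s i * ln \<bar>?l s i\<bar>) field_differentiable (at 0)"
      by (intro field_differentiable_sum diff)
    then have "(\<lambda>s. - (c \<bullet> v + s * (c \<bullet> w)) - (\<Sum>i\<in>N-{q}. ?l s i * ln \<bar>?l s i\<bar>)) field_differentiable (at 0)"
      by (intro field_differentiable_diff field_differentiable_minus field_differentiable_add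
          field_differentiable_mult field_differentiable_ident
          field_differentiable_const) auto
    moreover have "- (c \<bullet> v + s * (c \<bullet> w)) - (\<Sum>i\<in>N-{q}. ?l s i * ln \<bar>?l s i\<bar>) = s * ln \<bar>s\<bar>" for s
    proof -
      have "(\<Sum>i\<in>N. ?l s i * ln \<bar>?l s i\<bar>) + c \<bullet> (v + s *\<^sub>R w) = 0"
        using rel lW by blast
      moreover have "?l s q = s" using v w by (simp add: K_def)
      ultimately show ?thesis
        using q by (simp add: sum.remove[of N q] inner_add_right)
    qed
    ultimately show False
      using x_ln_abs_not_differentiable_0 by (simp add: field_differentiable_def)
  qed
  then obtain r a where r: "r \<noteq> q" "a \<noteq> 0" "\<forall>u\<in>W. u $ r = a * u $ q" by blast
  let ?x = "axis r 1 - axis q a"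
  have "?x \<in> (W\<^sup>\<bottom>)"
    using r by (auto simp: orthogonal_comp_def orthogonal_def inner_axis inner_diff_right)
  moreover have "{i. ?x $ i \<noteq> 0} = {q, r}" using r by (auto simp: axis_def)
  ultimately show ?thesis using r by (intro exI[of _ ?x]) (auto simp: axis_def)
qed

section \<open>The first order condition at a maximum of the volume\<close>

text \<open>
  The tangent directions \<open>u\<close> of \<open>SAS G k\<close>: the real solutions of the homogeneous additive equations
  of the defining ones. Moving in the direction \<open>u\<close> multiplies \<open>x q\<close> by \<open>cis (t * u $ q)\<close>. They are
  encoded as vectors indexed by the quadrilaterals, to have an inner product at hand.
\<close>

definition deformations :: "'a::finite gluing \<Rightarrow> (real ^ 'a quad) set" where
  "deformations G = {u. (\<forall>\<sigma>. (\<Sum>j\<in>UNIV. u $ (\<sigma>, j)) = 0) \<and>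
    (\<forall>e\<in>edges G. (\<Sum>q\<in>UNIV. real (quad_index q e) * u $ q) = 0)}"

lemma subspace_deformations: "subspace (deformations G)"
proof -
  have "(\<Sum>q\<in>UNIV. f q * (c * u $ q)) = c * (\<Sum>q\<in>UNIV. f q * u $ q)"
    for f and c :: real and u :: "real ^ 'a quad"
    by (simp add: sum_distrib_left mult.left_commute)
  then show ?thesis
    unfolding subspace_def deformations_def
    by (auto simp: sum.distrib distrib_left simp flip: sum_distrib_left)
qed

lemma deformation_in_SAS:
  assumes "p \<in> SAS G k" "u \<in> deformations G"
  shows "(\<lambda>q. p q * cis (t * u $ q)) \<in> SAS G k"
proof -
  have cis_prod: "(\<Prod>q\<in>A. cis (f q)) = cis (\<Sum>q\<in>A. f q)" for A :: "'x set" and f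
    by (induction A rule: infinite_finite_induct) (auto simp: cis_mult)
  have "(\<Prod>j\<in>UNIV. p (\<sigma>, j) * cis (t * u $ (\<sigma>, j))) = - 1" for \<sigma>
    using assms by (simp add: SAS_def deformations_def prod.distrib cis_prod flip: sum_distrib_left)
  moreover have "(\<Prod>q\<in>UNIV. (p q * cis (t * u $ q)) ^ quad_index q e) = k e" if "e \<in> edges G" for e
  proof -
    have "(\<Prod>q\<in>UNIV. (p q * cis (t * u $ q)) ^ quad_index q e)
        = k e * cis (\<Sum>q\<in>UNIV. t * (real (quad_index q e) * u $ q))"
      using assms that
      by (simp add: SAS_def power_mult_distrib prod.distrib Complex.DeMoivre cis_prod mult.left_commute)
    then show ?thesis
      using assms that by (simp add: deformations_def flip: sum_distrib_left)
  qed
  ultimately show ?thesis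
    using assms by (auto simp: SAS_def norm_mult)
qed

lemma lobachevsky_Arg_smooth:
  assumes "cmod z = 1" "z \<noteq> 1" "z \<noteq> - 1"
  shows "((\<lambda>t. (lobachevsky (Arg (z * cis (t * u))) - lobachevsky (Arg z)) / t)
      \<longlongrightarrow> - (u * ln \<bar>2 * sin (Arg z)\<bar>)) (at_right 0)"
proof -
  have z: "z = cis (Arg z)" using assms(1) by (metis cis_Arg norm_zero sgn_eq zero_neq_one of_real_1 div_by_1)
  then have a: "- pi < Arg z" "Arg z < pi" "Arg z \<noteq> 0"
    using assms Arg_bounded[of z] cis_pi cis_zero by (auto simp: less_le)
  have "((\<lambda>t. lobachevsky (Arg z + t * u)) has_real_derivative - ln \<bar>2 * sin (Arg z + 0 * u)\<bar> * u) (at 0)"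
    using a by (intro DERIV_chain2[OF has_field_derivative_lobachevsky]) (auto intro!: derivative_eq_intros)
  then have "((\<lambda>t. (lobachevsky (Arg z + t * u) - lobachevsky (Arg z)) / t)
      \<longlongrightarrow> - (u * ln \<bar>2 * sin (Arg z)\<bar>)) (at_right 0)"
    by (simp add: DERIV_def filterlim_at_split mult.commute)
  moreover have "\<forall>\<^sub>F t in at_right 0. Arg z + t * u \<in> {- pi<..<pi}"
  proof -
    have "((\<lambda>t. Arg z + t * u) \<longlongrightarrow> Arg z + 0 * u) (at_right 0)"
      by (intro tendsto_intros)
    then show ?thesis using a by (intro topological_tendstoD) auto
  qed
  then have "\<forall>\<^sub>F t in at_right 0. Arg (z * cis (t * u)) = Arg z + t * u"
  proof (rule eventually_mono)
    fix t assume t: "Arg z + t * u \<in> {- pi<..<pi}"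
    have "z * cis (t * u) = cis (Arg z + t * u)" using z by (metis cis_mult)
    with t show "Arg (z * cis (t * u)) = Arg z + t * u" by (simp add: Arg_cis)
  qed
  then have "\<forall>\<^sub>F t in at_right 0. (lobachevsky (Arg z + t * u) - lobachevsky (Arg z)) / t =
      (lobachevsky (Arg (z * cis (t * u))) - lobachevsky (Arg z)) / t"
    by (rule eventually_mono) simp
  ultimately show ?thesis by (rule Lim_transform_eventually)
qed

text \<open>
  Here \<open>\<Lambda>(\<pi>) = 0\<close> is what makes up for the jump of the argument at \<open>-1\<close>.
\<close>

lemma lobachevsky_Arg_sign:
  assumes "z = 1 \<or> z = - 1" "\<bar>s\<bar> < pi"
  shows "lobachevsky (Arg (z * cis s)) = lobachevsky s"
proof -
  have arg: "Arg (cis t) = t" if "- pi < t" "t \<le> pi" for t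
    using that by (simp add: Arg_cis)
  consider "z = 1" | "z = - 1" "0 < s" | "z = - 1" "s \<le> 0" using assms(1) by linarith
  then show ?thesis
  proof cases
    case 1
    then show ?thesis using assms(2) by (simp add: arg)
  next
    case 2
    have "- cis s = cis (s - pi)" by (simp add: complex_eq_iff)
    then have "Arg (z * cis s) = - (pi - s)" using 2 assms(2) by (simp add: arg)
    then show ?thesis
      using lobachevsky_reflect[of s] 2 assms(2) by (simp only: lobachevsky_minus) simp
  next
    case 3
    have "- cis s = cis (s + pi)" by (simp add: complex_eq_iff)
    then have "Arg (z * cis s) = pi - (- s)" using 3 assms(2) by (simp add: arg)
    then show ?thesis
      using lobachevsky_reflect[of "- s"] 3 assms(2) by (simp only: lobachevsky_minus) (simp add: lobachevsky_minus)
  qed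
qed

text \<open>
  At a point \<open>\<plusminus>1\<close> the difference quotient diverges like \<open>- u ln t\<close>; the lemma gives the next term. For
  \<open>u = 0\<close> all terms are zero.
\<close>

lemma lobachevsky_Arg_nonsmooth:
  assumes "z = 1 \<or> z = - 1"
  shows "((\<lambda>t. (lobachevsky (Arg (z * cis (t * u))) - lobachevsky (Arg z)) / t + u * ln t)
      \<longlongrightarrow> u * (1 - ln 2) - u * ln \<bar>u\<bar>) (at_right 0)"
proof (cases "u = 0")
  case True
  then show ?thesis by simp
next
  case False
  have lim: "filterlim (\<lambda>t. t * u) (at 0) (at_right 0)"
    unfolding filterlim_at using False
    by (auto intro!: tendsto_eq_intros simp: eventually_at_filter)
  have "((\<lambda>t. u * (lobachevsky (t * u) / (t * u) + ln \<bar>t * u\<bar>) - u * ln \<bar>u\<bar>)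
      \<longlongrightarrow> u * (1 - ln 2) - u * ln \<bar>u\<bar>) (at_right 0)"
    by (intro tendsto_intros filterlim_compose[OF lobachevsky_asymp_0 lim])
  moreover have "\<forall>\<^sub>F t in at_right 0. \<bar>t * u\<bar> < pi"
  proof -
    have "((\<lambda>t. \<bar>t * u\<bar>) \<longlongrightarrow> \<bar>0 * u\<bar>) (at_right 0)"
      by (intro tendsto_intros)
    then show ?thesis by (rule order_tendstoD) simp
  qed
  then have "\<forall>\<^sub>F t in at_right 0. u * (lobachevsky (t * u) / (t * u) + ln \<bar>t * u\<bar>) - u * ln \<bar>u\<bar> =
      (lobachevsky (Arg (z * cis (t * u))) - lobachevsky (Arg z)) / t + u * ln t"
    using eventually_at_right_less[of 0]
  proof eventually_elim
    case (elim t)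
    have "lobachevsky (Arg z) = 0" using lobachevsky_Arg_sign[OF assms, of 0] by simp
    moreover have "lobachevsky (Arg (z * cis (t * u))) = lobachevsky (t * u)"
      using elim by (intro lobachevsky_Arg_sign[OF assms])
    moreover have "ln \<bar>t * u\<bar> = ln t + ln \<bar>u\<bar>"
      using elim False by (simp add: abs_mult ln_mult)
    ultimately show ?case using elim False by (simp add: field_simps)
  qed
  ultimately show ?thesis by (rule Lim_transform_eventually)
qed

text \<open>
  The first order condition at a maximum. Along \<open>u\<close> the difference quotient of the volume is
  \<open>- A(u) ln t + A(u) (1 - ln 2) - h(u) + o(1)\<close> as \<open>t\<close> tends to \<open>0\<close> from above, where \<open>A(u)\<close> is the sum
  of \<open>u\<close> over the quadrilaterals at which \<open>p\<close> is \<open>\<plusminus>1\<close> and \<open>h(u)\<close> is the expression below. The quotient is never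
  positive, so \<open>A(u) \<le> 0\<close>; replacing \<open>u\<close> by \<open>-u\<close> gives \<open>A = 0\<close>. Then \<open>h \<ge> 0\<close>, and \<open>h\<close> is odd.
\<close>

lemma critical_point:
  fixes G :: "'a::finite gluing"
  assumes p: "p \<in> SAS G k" and max: "\<forall>x\<in>SAS G k. angle_volume x \<le> angle_volume p"
    and u: "u \<in> deformations G"
  defines "N \<equiv> {q. p q = 1 \<or> p q = - 1}"
  shows "(\<Sum>q\<in>N. u $ q * ln \<bar>u $ q\<bar>) + (\<Sum>q\<in>-N. u $ q * ln \<bar>2 * sin (Arg (p q))\<bar>) = 0"
proof -
  define A where "A u = (\<Sum>q\<in>N. u $ q)" for u :: "real ^ 'a quad"
  define h where "h u = (\<Sum>q\<in>N. u $ q * ln \<bar>u $ q\<bar>) + (\<Sum>q\<in>-N. u $ q * ln \<bar>2 * sin (Arg (p q))\<bar>)"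
    for u :: "real ^ 'a quad"
  define g where "g u t = (angle_volume (\<lambda>q. p q * cis (t * u $ q)) - angle_volume p) / t"
    for u :: "real ^ 'a quad" and t
  have lim: "((\<lambda>t. g u t + A u * ln t) \<longlongrightarrow> A u * (1 - ln 2) - h u) (at_right 0)"
    for u :: "real ^ 'a quad"
  proof -
    let ?d = "\<lambda>q t. (lobachevsky (Arg (p q * cis (t * u $ q))) - lobachevsky (Arg (p q))) / t"
    have "((\<lambda>t. (\<Sum>q\<in>N. ?d q t + u $ q * ln t) + (\<Sum>q\<in>-N. ?d q t)) \<longlongrightarrow>
        (\<Sum>q\<in>N. u $ q * (1 - ln 2) - u $ q * ln \<bar>u $ q\<bar>) +
        (\<Sum>q\<in>-N. - (u $ q * ln \<bar>2 * sin (Arg (p q))\<bar>))) (at_right 0)"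
    proof (intro tendsto_add tendsto_sum)
      show "((\<lambda>t. ?d q t + u $ q * ln t) \<longlongrightarrow> u $ q * (1 - ln 2) - u $ q * ln \<bar>u $ q\<bar>) (at_right 0)"
        if "q \<in> N" for q
        using that by (intro lobachevsky_Arg_nonsmooth) (simp add: N_def)
      show "(?d q \<longlongrightarrow> - (u $ q * ln \<bar>2 * sin (Arg (p q))\<bar>)) (at_right 0)" if "q \<in> - N" for q
        using that p by (cases q, intro lobachevsky_Arg_smooth) (auto simp: N_def SAS_def)
    qed
    moreover have "(\<Sum>q\<in>N. ?d q t + u $ q * ln t) + (\<Sum>q\<in>-N. ?d q t) = g u t + A u * ln t" for t
      using sum.union_disjoint[of N "- N" "\<lambda>q. ?d q t"]
      by (simp add: g_def A_def angle_volume_def sum.distrib sum_distrib_right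
          flip: sum_divide_distrib sum_subtractf)
    moreover have "(\<Sum>q\<in>N. u $ q * (1 - ln 2) - u $ q * ln \<bar>u $ q\<bar>) +
        (\<Sum>q\<in>-N. - (u $ q * ln \<bar>2 * sin (Arg (p q))\<bar>)) = A u * (1 - ln 2) - h u"
      by (simp add: A_def h_def sum_subtractf sum_negf sum_distrib_right)
    ultimately show ?thesis by simp
  qed
  have neg: "\<forall>\<^sub>F t in at_right 0. g u t \<le> 0" if "u \<in> deformations G" for u
    using eventually_at_right_less[of 0]
    by eventually_elim
      (use max deformation_in_SAS[OF p that] in \<open>auto simp: g_def divide_le_0_iff\<close>)
  have A_le: "A u \<le> 0" if "u \<in> deformations G" for u
  proof (rule ccontr)
    assume "\<not> ?thesis"
    then have "filterlim (\<lambda>t. A u * ln t) at_bot (at_right 0)"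
      by (intro filterlim_tendsto_pos_mult_at_bot[OF tendsto_const] ln_at_0) auto
    moreover have "\<forall>\<^sub>F t in at_right 0. g u t + A u * ln t \<le> A u * ln t"
      using neg[OF that] by eventually_elim simp
    ultimately have "filterlim (\<lambda>t. g u t + A u * ln t) at_bot (at_right 0)"
      by (rule filterlim_at_bot_mono)
    then show False
      using not_tendsto_and_filterlim_at_infinity[OF trivial_limit_at_right_real lim[of u]]
        filterlim_at_bot_imp_at_infinity by blast
  qed
  have minus: "- u \<in> deformations G" if "u \<in> deformations G" for u
    using subspace_deformations that by (rule subspace_neg)
  have A: "A u = 0" if "u \<in> deformations G" for u
    using A_le[OF that] A_le[OF minus[OF that]] by (simp add: A_def sum_negf)
  have h_ge: "0 \<le> h u" if "u \<in> deformations G" for u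
  proof -
    have "(g u \<longlongrightarrow> - h u) (at_right 0)" using lim[of u] A[OF that] by simp
    from tendsto_upperbound[OF this neg[OF that]] show ?thesis by simp
  qed
  moreover have "h (- u) = - h u" by (simp add: h_def sum_negf)
  ultimately have "h u = 0" using u minus[OF u] by (metis neg_0_le_iff_le order_antisym)
  then show ?thesis by (simp add: h_def)
qed

section \<open>The cyclic order of the quadrilaterals and the index vectors\<close>

text \<open>
  The quadrilateral disjoint from an edge, given by its pair of end points; the value at a set that
  is not a pair is arbitrary.
\<close>

definition facing_quad :: "vert set \<Rightarrow> quad_type" where
  "facing_quad s = (if s \<in> disjoint_edges Q01_23 then Q01_23
    else if s \<in> disjoint_edges Q02_13 then Q02_13 else Q03_12)"

text \<open>
  The antisymmetric function on quadrilateral types that is \<open>1\<close> on consecutive ones: \<open>\<omega>\<close>, restricted to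
  one tetrahedron.
\<close>

definition cyclic_sign :: "quad_type \<Rightarrow> quad_type \<Rightarrow> real" where
  "cyclic_sign q q' = (if q' = next_quad q then 1 else if q = next_quad q' then - 1 else 0)"

lemma facing_quad_simps:
  "facing_quad {V0, V1} = Q01_23" "facing_quad {V1, V0} = Q01_23"
  "facing_quad {V2, V3} = Q01_23" "facing_quad {V3, V2} = Q01_23"
  "facing_quad {V0, V2} = Q02_13" "facing_quad {V2, V0} = Q02_13"
  "facing_quad {V1, V3} = Q02_13" "facing_quad {V3, V1} = Q02_13"
  "facing_quad {V0, V3} = Q03_12" "facing_quad {V3, V0} = Q03_12"
  "facing_quad {V1, V2} = Q03_12" "facing_quad {V2, V1} = Q03_12"
  by (simp_all add: facing_quad_def doubleton_eq_iff)

text \<open>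
  The edges of a tetrahedron.
\<close>

definition vertex_pairs :: "vert set set" where
  "vertex_pairs = {s. card s = 2}"

lemma vertex_pairs_eq: "vertex_pairs = {{u, w} | u w. u \<noteq> w}"
  by (auto simp: vertex_pairs_def card_2_iff)

lemma disjoint_edges_facing_quad: "disjoint_edges q = {s \<in> vertex_pairs. facing_quad s = q}"
proof -
  have "{u, w} \<in> disjoint_edges q \<longleftrightarrow> facing_quad {u, w} = q" if "u \<noteq> w" for u w
    using that
    by (cases u; cases w; simp add: facing_quad_simps; cases q; simp add: doubleton_eq_iff)
  moreover have "s \<in> vertex_pairs" if "s \<in> disjoint_edges q" for s
    using that by (cases q) (auto simp: vertex_pairs_def)
  ultimately show ?thesis unfolding vertex_pairs_eq by blast
qed

lemma next_quad_cycle: "next_quad (next_quad (next_quad q)) = q"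
  by (cases q) simp_all

lemma vertex_pairs_image: "bij f \<Longrightarrow> s \<in> vertex_pairs \<Longrightarrow> f ` s \<in> vertex_pairs"
  by (force simp: vertex_pairs_eq bij_def inj_eq)

text \<open>
  The transposition of quadrilateral types fixing \<open>r\<close>. This is the effect of swapping the two vertices
  of an edge that \<open>r\<close> is disjoint from.
\<close>

definition reflect_quad :: "quad_type \<Rightarrow> quad_type \<Rightarrow> quad_type" where
  "reflect_quad r q = (if q = r then r else if q = next_quad r then next_quad q else next_quad (next_quad q))"

lemma facing_quad_transpose:
  assumes "a \<noteq> b" "s \<in> vertex_pairs"
  shows "facing_quad (Transposition.transpose a b ` s) = reflect_quad (facing_quad {a, b}) (facing_quad s)"
proof -
  obtain u w where s: "s = {u, w}" "u \<noteq> w" using assms(2) by (auto simp: vertex_pairs_eq)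
  show ?thesis
    using assms(1) s(2) unfolding s(1)
    by (cases a; cases b; simp; cases u; cases w; simp add: facing_quad_simps reflect_quad_def Transposition.transpose_def)
qed

lemma cyclic_sign_reflect: "cyclic_sign (reflect_quad r q) (reflect_quad r q') = - cyclic_sign q q'"
  unfolding cyclic_sign_def reflect_quad_def by (cases r; cases q; cases q') auto

text \<open>
  Vertex permutations act on the three quadrilateral types, and odd ones reverse the cyclic order.
\<close>

lemma cyclic_sign_permute:
  assumes "bij \<pi>" "s \<in> vertex_pairs" "s' \<in> vertex_pairs"
  shows "cyclic_sign (facing_quad (\<pi> ` s)) (facing_quad (\<pi> ` s'))
    = of_int (sign \<pi>) * cyclic_sign (facing_quad s) (facing_quad s')"
proof -
  have "\<pi> permutes UNIV" using bij_imp_permutes[OF assms(1)] by simp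
  then show ?thesis using finite
  proof (induction rule: permutes_induct)
    case id
    then show ?case by simp
  next
    case (swap a b p)
    have "bij p" using swap by (simp add: permutes_bij)
    then have ps: "p ` s \<in> vertex_pairs" "p ` s' \<in> vertex_pairs" using assms vertex_pairs_image by auto
    have sign: "sign (Transposition.transpose a b \<circ> p) = - sign p"
      using swap permutation_permutes[of p]
      by (subst sign_compose) (auto simp: permutation_swap_id sign_swap_id)
    have facing: "facing_quad ((Transposition.transpose a b \<circ> p) ` r) =
        reflect_quad (facing_quad {a, b}) (facing_quad (p ` r))" if "p ` r \<in> vertex_pairs" for r
      using facing_quad_transpose[OF \<open>a \<noteq> b\<close> that] by (simp only: image_comp)
    show ?case
      unfolding sign facing[OF ps(1)] facing[OF ps(2)] cyclic_sign_reflect using swap by simp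
  qed
qed

text \<open>
  Edges facing different quadrilaterals share a vertex, so they lie in exactly one common face, the one
  opposite to the only vertex that is on neither of them.
\<close>

lemma cyclic_sign_mult_common_faces:
  assumes "s \<in> vertex_pairs" "s' \<in> vertex_pairs"
  shows "cyclic_sign (facing_quad s) (facing_quad s') * real (card {i. i \<notin> s \<and> i \<notin> s'})
    = cyclic_sign (facing_quad s) (facing_quad s')"
proof -
  have *: "card {i. i \<notin> s \<and> i \<notin> s'} = 4 - card (s \<union> s')"
  proof -
    have "{i. i \<notin> s \<and> i \<notin> s'} = UNIV - (s \<union> s')" by auto
    then show ?thesis by (simp add: card_Diff_subset) (simp add: UNIV_vert)
  qed
  obtain u w where s: "s = {u, w}" "u \<noteq> w" using assms(1) by (auto simp: vertex_pairs_eq)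
  obtain u' w' where s': "s' = {u', w'}" "u' \<noteq> w'" using assms(2) by (auto simp: vertex_pairs_eq)
  show ?thesis
    using s(2) s'(2) unfolding * unfolding s(1) s'(1)
    by (cases u; cases w; simp; cases u'; cases w'; simp add: facing_quad_simps cyclic_sign_def card_insert_if)
qed

lemma equivclp_glued_mem:
  assumes "c \<in> A // {(a, b). equivclp R a b}" "R a b"
  shows "a \<in> c \<longleftrightarrow> b \<in> c"
proof -
  obtain x where "c = {b. equivclp R x b}" using assms(1) by (auto simp: quotient_def)
  moreover have "equivclp R a b" using assms(2) by (rule r_into_equivclp)
  ultimately show ?thesis by (auto dest: equivclp_trans equivclp_sym)
qed

lemma real_quad_index:
  "real (quad_index (\<sigma>, j) e) = (\<Sum>s\<in>disjoint_edges j. of_bool ((\<sigma>, s) \<in> e))"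
proof -
  have "{a \<in> e. fst a = fst (\<sigma>, j) \<and> snd a \<in> disjoint_edges (snd (\<sigma>, j))} = Pair \<sigma> ` {s \<in> disjoint_edges j. (\<sigma>, s) \<in> e}"
    by auto
  then have "quad_index (\<sigma>, j) e = card {s \<in> disjoint_edges j. (\<sigma>, s) \<in> e}"
    by (simp add: quad_index_def card_image inj_on_def)
  then show ?thesis by (simp add: of_bool_def sum.If_cases Int_def)
qed

lemma sum_vertex_pairs_by_quad: "(\<Sum>s\<in>vertex_pairs. h s) = (\<Sum>j\<in>UNIV. \<Sum>s\<in>disjoint_edges j. h s)"
  unfolding disjoint_edges_facing_quad by (rule sum.group[symmetric]) auto

lemma edge_mem_glued:
  assumes "G (\<sigma>, i) = (\<tau>, \<pi>)" "e \<in> edges G" "s \<in> vertex_pairs" "i \<notin> s"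
  shows "(\<tau>, \<pi> ` s) \<in> e \<longleftrightarrow> (\<sigma>, s) \<in> e"
proof -
  obtain u w where "s = {u, w}" "u \<noteq> w" using assms(3) by (auto simp: vertex_pairs_eq)
  then have "edge_glued G (\<sigma>, s) (\<tau>, \<pi> ` s)"
    using assms unfolding edge_glued_def by fastforce
  with equivclp_glued_mem assms(2) show ?thesis unfolding edges_def by metis
qed

text \<open>
  The form \<open>\<omega>\<close> vanishes on the index vectors \<open>i(-,e)\<close>. The sum counts, with sign, the pairs of an edge
  in the class \<open>e\<close> and an edge in the class \<open>e'\<close> in a common face of a tetrahedron. Passing to the other
  side of the face is an involution of these pairs, and it changes the sign because the vertex map is
  odd.
\<close>

lemma quad_index_symplectic:
  fixes G :: "'a::finite gluing"
  assumes G: "oriented_triangulation G" and e: "e \<in> edges G" "e' \<in> edges G"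
  shows "(\<Sum>\<sigma>\<in>UNIV. \<Sum>j\<in>UNIV. \<Sum>j'\<in>UNIV.
    cyclic_sign j j' * real (quad_index (\<sigma>, j) e) * real (quad_index (\<sigma>, j') e')) = 0"
proof -
  define I :: "'a tet_edge set \<Rightarrow> 'a \<Rightarrow> vert set \<Rightarrow> real" where "I c \<sigma> s = of_bool ((\<sigma>, s) \<in> c)" for c \<sigma> s
  \<comment> \<open>\<open>X\<close> lists the pairs of edges \<open>s, s'\<close> in the face of \<open>\<sigma>\<close> opposite to \<open>i\<close>, and \<open>\<Phi>\<close> crosses this face.\<close>
  define f where "f = (\<lambda>(\<sigma>, s, s', i :: vert). cyclic_sign (facing_quad s) (facing_quad s') * I e \<sigma> s * I e' \<sigma> s')"
  define X where "X = (SIGMA \<sigma>:(UNIV :: 'a set). SIGMA s:vertex_pairs. SIGMA s':vertex_pairs. {i. i \<notin> s \<and> i \<notin> s'})"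
  define \<Phi> where "\<Phi> = (\<lambda>(\<sigma>, s, s', i). case G (\<sigma>, i) of (\<tau>, \<pi>) \<Rightarrow> (\<tau>, \<pi> ` s, \<pi> ` s', \<pi> i))"
  have \<Phi>: "\<Phi> (\<Phi> a) = a \<and> \<Phi> a \<in> X \<and> - f (\<Phi> a) = f a" if "a \<in> X" for a
  proof -
    obtain \<sigma> s s' i where a: "a = (\<sigma>, s, s', i)" by (metis prod_cases4)
    have s: "s \<in> vertex_pairs" "s' \<in> vertex_pairs" "i \<notin> s" "i \<notin> s'"
      using that by (auto simp: a X_def)
    obtain \<tau> \<pi> where g: "G (\<sigma>, i) = (\<tau>, \<pi>)" by fastforce
    have \<pi>: "bij \<pi>" "\<not> evenperm \<pi>" and inv: "G (\<tau>, \<pi> i) = (\<sigma>, inv \<pi>)"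
      using G g unfolding oriented_triangulation_def by blast+
    have \<Phi>a: "\<Phi> a = (\<tau>, \<pi> ` s, \<pi> ` s', \<pi> i)" by (simp add: \<Phi>_def a g)
    have "\<Phi> (\<Phi> a) = a"
      using \<pi>(1) unfolding \<Phi>a by (simp add: \<Phi>_def a inv image_inv_f_f bij_is_inj)
    moreover have "\<Phi> a \<in> X"
      using s \<pi>(1) unfolding \<Phi>a by (auto simp: X_def vertex_pairs_image bij_def inj_eq)
    moreover have "cyclic_sign (facing_quad (\<pi> ` s)) (facing_quad (\<pi> ` s'))
        = - cyclic_sign (facing_quad s) (facing_quad s')"
      using cyclic_sign_permute[OF \<pi>(1) s(1,2)] \<pi>(2) by (simp add: sign_def)
    then have "- f (\<Phi> a) = f a"
      unfolding \<Phi>a using edge_mem_glued[where G = G, OF g] e s by (simp add: f_def a I_def)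
    ultimately show ?thesis by blast
  qed
  have "sum f X = (\<Sum>a\<in>X. - f a)"
    by (rule sum.reindex_bij_witness[where i = \<Phi> and j = \<Phi>]) (use \<Phi> in auto)
  then have zero: "sum f X = 0" by (simp add: sum_negf)
  have "sum f X = (\<Sum>\<sigma>\<in>UNIV. \<Sum>s\<in>vertex_pairs. \<Sum>s'\<in>vertex_pairs. \<Sum>i\<in>{i. i \<notin> s \<and> i \<notin> s'}. f (\<sigma>, s, s', i))"
    by (simp add: X_def sum.Sigma)
  also have "\<dots> = (\<Sum>\<sigma>\<in>UNIV. \<Sum>s\<in>vertex_pairs. \<Sum>s'\<in>vertex_pairs.
      cyclic_sign (facing_quad s) (facing_quad s') * I e \<sigma> s * I e' \<sigma> s')"
  proof (intro sum.cong refl)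
    fix \<sigma> s s' assume "s \<in> vertex_pairs" "s' \<in> vertex_pairs"
    from cyclic_sign_mult_common_faces[OF this]
    show "(\<Sum>i\<in>{i. i \<notin> s \<and> i \<notin> s'}. f (\<sigma>, s, s', i)) =
      cyclic_sign (facing_quad s) (facing_quad s') * I e \<sigma> s * I e' \<sigma> s'"
      by (simp add: f_def ac_simps)
  qed
  also have "\<dots> = (\<Sum>\<sigma>\<in>UNIV. \<Sum>j\<in>UNIV. \<Sum>s\<in>disjoint_edges j. \<Sum>j'\<in>UNIV. \<Sum>s'\<in>disjoint_edges j'.
      cyclic_sign j j' * I e \<sigma> s * I e' \<sigma> s')"
    unfolding sum_vertex_pairs_by_quad by (intro sum.cong refl) (simp add: disjoint_edges_facing_quad)
  also have "\<dots> = (\<Sum>\<sigma>\<in>UNIV. \<Sum>j\<in>UNIV. \<Sum>j'\<in>UNIV.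
    cyclic_sign j j' * real (quad_index (\<sigma>, j) e) * real (quad_index (\<sigma>, j') e'))"
    unfolding real_quad_index I_def[symmetric]
    by (intro sum.cong refl, subst sum.swap)
      (simp add: mult.assoc sum_product, simp add: sum_distrib_left)
  finally show ?thesis using zero by simp
qed

lemma sum_UNIV_quads: "(\<Sum>q\<in>UNIV. f q) = (\<Sum>\<sigma>\<in>UNIV. \<Sum>j\<in>UNIV. f (\<sigma>, j))"
  by (simp add: sum.cartesian_product)

text \<open>
  The leading-trailing deformation of an edge \<open>e\<close>: at \<open>q\<close>, the index of the quadrilateral preceding \<open>q\<close>
  minus that of the one following \<open>q\<close>. In a cyclic order of length three the predecessor is the second
  successor.
\<close>

definition leading_trailing :: "'a::finite tet_edge set \<Rightarrow> real ^ 'a quad" where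
  "leading_trailing e = (\<chi> q. real (quad_index (fst q, next_quad (next_quad (snd q))) e)
    - real (quad_index (fst q, next_quad (snd q)) e))"

lemma sum_cyclic_sign:
  "(\<Sum>j'\<in>UNIV. cyclic_sign j j' * x j') = x (next_quad j) - x (next_quad (next_quad j))"
  by (cases j) (simp_all add: UNIV_quad_type cyclic_sign_def)

lemma leading_trailing_deformation:
  fixes G :: "'a::finite gluing"
  assumes "oriented_triangulation G" "e \<in> edges G"
  shows "leading_trailing e \<in> deformations G"
proof -
  have "(\<Sum>j\<in>UNIV. leading_trailing e $ (\<sigma>, j)) = 0" for \<sigma> :: 'a
    by (simp add: leading_trailing_def UNIV_quad_type)
  moreover have "(\<Sum>q\<in>UNIV. real (quad_index q d) * leading_trailing e $ q) = 0"
    if "d \<in> edges G" for d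
  proof -
    have "(\<Sum>j\<in>UNIV. \<Sum>j'\<in>UNIV. cyclic_sign j j' * real (quad_index (\<sigma>, j) d) * real (quad_index (\<sigma>, j') e))
        = - (\<Sum>j\<in>UNIV. real (quad_index (\<sigma>, j) d) * leading_trailing e $ (\<sigma>, j))" for \<sigma>
    proof -
      have "(\<Sum>j'\<in>UNIV. cyclic_sign j j' * real (quad_index (\<sigma>, j) d) * real (quad_index (\<sigma>, j') e))
         = - (real (quad_index (\<sigma>, j) d) * leading_trailing e $ (\<sigma>, j))" for j
        using sum_cyclic_sign[of j "\<lambda>j'. real (quad_index (\<sigma>, j) d) * real (quad_index (\<sigma>, j') e)"]
        by (simp add: leading_trailing_def mult.assoc algebra_simps)
      then show ?thesis by (simp add: sum_negf)
    qed
    then show ?thesis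
      using quad_index_symplectic[OF assms(1) that assms(2)]
      by (simp add: sum_UNIV_quads sum_negf)
  qed
  ultimately show ?thesis by (simp add: deformations_def)
qed

section \<open>Solutions to Thurston's equation\<close>

text \<open>
  For angles adding up to \<open>\<pi>\<close>, the shape parameters of a triangle with these angles,
  \<open>sin b / sin c * cis a\<close> and its cyclic analogues, satisfy the relation \<open>z' (1 - z) = 1\<close>. The identity
  needs the sum only modulo \<open>2\<pi>\<close>.
\<close>

lemma shape_parameter_relation:
  fixes a b c :: real
  assumes "cis a * cis b * cis c = - 1" "sin a \<noteq> 0" "sin c \<noteq> 0"
  shows "(of_real (sin c / sin a) * cis b) * (1 - of_real (sin b / sin c) * cis a) = 1"
proof -
  have "cis c = - cis (- (a + b))"
    using assms(1) by (metis (no_types) cis_inverse cis_mult cis_neq_zero eq_divide_imp inverse_eq_divide minus_divide_left mult.commute)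
  then have "sin c = - sin (- (a + b))"
    by (simp only: complex_eq_iff cis.sel uminus_complex.sel)
  then have c: "sin c = sin a * cos b + cos a * sin b"
    by (simp only: sin_minus sin_add minus_minus)
  have "of_real (sin c) - of_real (sin b) * cis a = of_real (sin a) * cis (- b)"
    by (simp add: complex_eq_iff c)
  then have "cis b * (of_real (sin c) - of_real (sin b) * cis a) = of_real (sin a)"
    by (simp add: cis_mult mult.left_commute)
  moreover have "(of_real (sin c / sin a) * cis b) * (1 - of_real (sin b / sin c) * cis a)
      = cis b * (of_real (sin c) - of_real (sin b) * cis a) / of_real (sin a)"
    using assms(2,3) by (simp add: field_simps)
  ultimately show ?thesis
    using assms(2) by simp
qed

text \<open>
  The modulus of the product over an edge is given by the first order condition in the direction of
  the leading-trailing deformation of the edge. The factors \<open>r\<close> may be negative, so only their squares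
  are controlled.
\<close>

lemma thurston_solution_of_smooth_maximum:
  fixes G :: "'a::finite gluing"
  assumes G: "oriented_triangulation G" and p: "p \<in> SAS G k"
    and max: "\<forall>x\<in>SAS G k. angle_volume x \<le> angle_volume p"
    and smooth: "smooth_point p"
  shows "\<exists>z :: 'a quad \<Rightarrow> complex. (\<forall>q q'. quad_arrow q q' \<longrightarrow> z q' * (1 - z q) = 1) \<and>
    (\<forall>e\<in>edges G. (\<Prod>q\<in>UNIV. z q ^ (2 * quad_index q e)) = (k e)\<^sup>2)"
proof -
  define a where "a q = Arg (p q)" for q
  define l where "l q = ln \<bar>2 * sin (a q)\<bar>" for q
  define r where "r = (\<lambda>(\<sigma>, j). sin (a (\<sigma>, next_quad j)) / sin (a (\<sigma>, next_quad (next_quad j))))"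
  define z where "z q = of_real (r q) * p q" for q
  have cis_a: "cis (a q) = p q" for q
  proof -
    have "cmod (p q) = 1" using p by (cases q) (simp add: SAS_def)
    then have "p q = cis (Arg (p q))"
      by (metis cis_Arg norm_zero sgn_eq zero_neq_one of_real_1 div_by_1)
    then show ?thesis by (simp add: a_def)
  qed
  have sin_a: "sin (a q) \<noteq> 0" for q
  proof
    assume "sin (a q) = 0"
    then have "cos (a q) = 1 \<or> cos (a q) = - 1"
      using sin_cos_squared_add[of "a q"] by (simp add: power2_eq_1_iff)
    then have "cis (a q) = 1 \<or> cis (a q) = - 1"
      using \<open>sin (a q) = 0\<close> by (auto simp: complex_eq_iff)
    then show False using smooth unfolding smooth_point_def cis_a by blast
  qed
  have shape: "z q' * (1 - z q) = 1" if "quad_arrow q q'" for q q'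
  proof -
    obtain \<sigma> j where q: "q = (\<sigma>, j)" by (cases q)
    have q': "q' = (\<sigma>, next_quad j)" using that by (cases q') (simp add: quad_arrow_def q)
    have "(\<Prod>j\<in>UNIV. p (\<sigma>, j)) = - 1" using p by (simp add: SAS_def)
    then have "cis (a (\<sigma>, j)) * cis (a (\<sigma>, next_quad j)) * cis (a (\<sigma>, next_quad (next_quad j))) = - 1"
      unfolding cis_a by (cases j) (simp_all add: UNIV_quad_type ac_simps)
    from shape_parameter_relation[OF this sin_a sin_a]
    show ?thesis by (simp add: q q' z_def r_def cis_a next_quad_cycle)
  qed
  have "(\<Prod>q\<in>UNIV. z q ^ (2 * quad_index q e)) = (k e)\<^sup>2" if e: "e \<in> edges G" for e
  proof -
    have r2: "(r (\<sigma>, j))\<^sup>2 = exp (2 * (l (\<sigma>, next_quad j) - l (\<sigma>, next_quad (next_quad j))))" for \<sigma> j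
    proof -
      have "exp (l q) = \<bar>2 * sin (a q)\<bar>" for q using sin_a by (simp add: l_def)
      then have "exp (l (\<sigma>, next_quad j) - l (\<sigma>, next_quad (next_quad j))) = \<bar>r (\<sigma>, j)\<bar>"
        by (simp add: exp_diff r_def abs_mult)
      then show ?thesis by (metis exp_double power2_abs)
    qed
    have "(\<Sum>q\<in>UNIV. leading_trailing e $ q * l q) = 0"
    proof -
      have no_sign: "{q. p q = 1 \<or> p q = - 1} = {}" using smooth by (auto simp: smooth_point_def)
      show ?thesis
        using critical_point[OF p max leading_trailing_deformation[OF G e]]
        unfolding no_sign by (simp add: l_def a_def)
    qed
    moreover have "(\<Sum>j\<in>UNIV. leading_trailing e $ (\<sigma>, j) * l (\<sigma>, j)) =
        (\<Sum>j\<in>UNIV. real (quad_index (\<sigma>, j) e) * (l (\<sigma>, next_quad j) - l (\<sigma>, next_quad (next_quad j))))" for \<sigma>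
      by (simp add: leading_trailing_def UNIV_quad_type algebra_simps)
    ultimately have zero: "(\<Sum>\<sigma>\<in>UNIV. \<Sum>j\<in>UNIV. real (quad_index (\<sigma>, j) e) *
        (l (\<sigma>, next_quad j) - l (\<sigma>, next_quad (next_quad j)))) = 0"
      by (simp add: sum_UNIV_quads)
    have "r q ^ (2 * quad_index q e) = exp (2 * (real (quad_index q e) *
        (l (fst q, next_quad (snd q)) - l (fst q, next_quad (next_quad (snd q))))))" for q
      by (cases q) (simp add: power_mult r2 ac_simps flip: exp_of_nat_mult)
    then have "(\<Prod>q\<in>UNIV. r q ^ (2 * quad_index q e)) = exp (2 * (\<Sum>\<sigma>\<in>UNIV. \<Sum>j\<in>UNIV. real (quad_index (\<sigma>, j) e) *
        (l (\<sigma>, next_quad j) - l (\<sigma>, next_quad (next_quad j)))))"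
      by (simp add: sum_distrib_left exp_sum prod.cartesian_product case_prod_unfold)
    then have "(\<Prod>q\<in>UNIV. r q ^ (2 * quad_index q e)) = 1" by (simp add: zero)
    then have "(\<Prod>q\<in>UNIV. complex_of_real (r q) ^ (2 * quad_index q e)) = 1"
      by (simp flip: of_real_power of_real_prod)
    moreover have "(\<Prod>q\<in>UNIV. p q ^ (2 * quad_index q e)) = (k e)\<^sup>2"
    proof -
      have "(\<Prod>q\<in>UNIV. p q ^ quad_index q e) = k e" using p e by (simp add: SAS_def)
      then show ?thesis
        by (simp add: mult.commute[of 2] power_mult flip: prod_power_distrib)
    qed
    ultimately show ?thesis by (simp add: z_def power_mult_distrib prod.distrib)
  qed
  with shape show ?thesis by blast
qed

section \<open>Solutions to Haken's equation\<close>

text \<open>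
  The orthogonal complement of the solution space of a linear system is spanned by the rows of the
  system: the indicator vectors of the tetrahedra and the index vectors of the edges.
\<close>

lemma orthogonal_deformations_span:
  fixes G :: "'a::finite gluing"
  assumes "x \<in> (deformations G)\<^sup>\<bottom>"
  shows "\<exists>\<alpha> \<beta>. \<forall>\<sigma> j. x $ (\<sigma>, j) = \<alpha> \<sigma> + (\<Sum>e\<in>edges G. \<beta> e * real (quad_index (\<sigma>, j) e))"
proof -
  define y :: "('a \<Rightarrow> real) \<Rightarrow> ('a tet_edge set \<Rightarrow> real) \<Rightarrow> real ^ 'a quad" where
    "y \<alpha> \<beta> = (\<chi> q. \<alpha> (fst q) + (\<Sum>e\<in>edges G. \<beta> e * real (quad_index q e)))" for \<alpha> \<beta>
  define U where "U = {y \<alpha> \<beta> | \<alpha> \<beta>. True}"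
  have add: "y \<alpha> \<beta> + y \<alpha>' \<beta>' = y (\<lambda>\<sigma>. \<alpha> \<sigma> + \<alpha>' \<sigma>) (\<lambda>e. \<beta> e + \<beta>' e)" for \<alpha> \<beta> \<alpha>' \<beta>'
    by (simp add: y_def vec_eq_iff distrib_right sum.distrib)
  have scale: "c *\<^sub>R y \<alpha> \<beta> = y (\<lambda>\<sigma>. c * \<alpha> \<sigma>) (\<lambda>e. c * \<beta> e)" for c \<alpha> \<beta>
    by (simp add: y_def vec_eq_iff distrib_left sum_distrib_left mult.assoc)
  have "subspace U"
    unfolding subspace_def
  proof (intro conjI ballI allI)
    have "0 = y (\<lambda>_. 0) (\<lambda>_. 0)" by (simp add: y_def vec_eq_iff)
    then show "0 \<in> U" unfolding U_def by blast
  qed (use add scale in \<open>unfold U_def; blast\<close>)+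
  moreover have "U\<^sup>\<bottom> \<subseteq> deformations G"
  proof
    fix w assume w: "w \<in> U\<^sup>\<bottom>"
    have fin: "finite (edges G)" by simp
    have 0: "(\<Sum>q\<in>UNIV. y \<alpha> \<beta> $ q * w $ q) = 0" for \<alpha> \<beta>
      using w unfolding U_def orthogonal_comp_def orthogonal_def by (auto simp: inner_vec_def)
    have "(\<Sum>j\<in>UNIV. w $ (\<sigma>, j)) = 0" for \<sigma>
    proof -
      have "(\<Sum>q\<in>UNIV. y (\<lambda>\<tau>. of_bool (\<tau> = \<sigma>)) (\<lambda>_. 0) $ q * w $ q)
          = (\<Sum>\<tau>\<in>UNIV. if \<tau> = \<sigma> then \<Sum>j\<in>UNIV. w $ (\<tau>, j) else 0)"
        unfolding sum_UNIV_quads by (intro sum.cong refl) (simp add: y_def)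
      also have "\<dots> = (\<Sum>j\<in>UNIV. w $ (\<sigma>, j))"
        by simp
      finally show ?thesis using 0 by simp
    qed
    moreover have "(\<Sum>q\<in>UNIV. real (quad_index q e) * w $ q) = 0" if "e \<in> edges G" for e
    proof -
      have "y (\<lambda>_. 0) (\<lambda>d. of_bool (d = e)) $ q = real (quad_index q e)" for q
      proof -
        have "y (\<lambda>_. 0) (\<lambda>d. of_bool (d = e)) $ q
            = (\<Sum>d\<in>edges G. if d = e then real (quad_index q d) else 0)"
          unfolding y_def vec_lambda_beta add_0 by (rule sum.cong) auto
        then show ?thesis using that fin by simp
      qed
      then show ?thesis using 0[of "\<lambda>_. 0" "\<lambda>d. of_bool (d = e)"] by simp
    qed
    ultimately show "w \<in> deformations G" by (simp add: deformations_def)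
  qed
  then have "x \<in> U\<^sup>\<bottom>\<^sup>\<bottom>" using assms by (auto simp: orthogonal_comp_def)
  ultimately have "x \<in> U" by (simp add: orthogonal_comp_self)
  then obtain \<alpha> \<beta> where "x = y \<alpha> \<beta>" unfolding U_def by blast
  then show ?thesis by (auto simp: y_def)
qed

lemma complementary_edge:
  assumes "{v, i} \<in> disjoint_edges q" "v \<noteq> i"
  shows "disjoint_edges q = {{v, i}, UNIV - {v, i}}"
  using assms unfolding UNIV_vert
  by (cases v; cases i; simp; cases q; simp add: doubleton_eq_iff insert_Diff_if insert_commute)

text \<open>
  If \<open>x\<close> is orthogonal to all deformations, then \<open>x(q) = \<alpha>(\<sigma>) + b(s) + b(s')\<close> for the two edges \<open>s, s'\<close>
  of \<open>\<sigma>\<close> disjoint from \<open>q\<close>, where \<open>b\<close> depends only on the class of an edge. The triangle coordinate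
  at the vertex \<open>v\<close> is taken to be \<open>- \<alpha>(\<sigma>)\<close> minus the values of \<open>b\<close> on the three edges at \<open>v\<close>. Then in the
  equation of an arc only the edges of the face containing the arc remain, and the two sides agree.
\<close>

lemma haken_solution_of_orthogonal:
  fixes G :: "'a::finite gluing"
  assumes G: "oriented_triangulation G" and x: "x \<in> (deformations G)\<^sup>\<bottom>"
  shows "\<exists>t. haken_solution G (t, \<lambda>q. x $ q)"
proof -
  obtain \<alpha> \<beta> where x: "\<And>\<sigma> j. x $ (\<sigma>, j) = \<alpha> \<sigma> + (\<Sum>e\<in>edges G. \<beta> e * real (quad_index (\<sigma>, j) e))"
    using orthogonal_deformations_span[OF x] by blast
  define b where "b \<sigma> s = (\<Sum>e\<in>edges G. \<beta> e * of_bool ((\<sigma>, s) \<in> e))" for \<sigma> s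
  have x_b: "x $ (\<sigma>, j) = \<alpha> \<sigma> + (\<Sum>s\<in>disjoint_edges j. b \<sigma> s)" for \<sigma> j
    unfolding x b_def real_quad_index sum_distrib_left by (subst sum.swap) (rule refl)
  define t where "t = (\<lambda>(\<sigma>, v). - \<alpha> \<sigma> - (\<Sum>w\<in>UNIV - {v}. b \<sigma> {v, w}))"
  have arc: "t (\<sigma>, v) + x $ (\<sigma>, j) = b \<sigma> (UNIV - {v, i}) - (\<Sum>w\<in>UNIV - {v, i}. b \<sigma> {v, w})"
    if "v \<noteq> i" "{v, i} \<in> disjoint_edges j" for \<sigma> v i j
  proof -
    have "UNIV - {v} = insert i (UNIV - {v, i})" using that by auto
    then have "(\<Sum>w\<in>UNIV - {v}. b \<sigma> {v, w}) = b \<sigma> {v, i} + (\<Sum>w\<in>UNIV - {v, i}. b \<sigma> {v, w})"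
      by simp
    moreover have "{v, i} \<noteq> UNIV - {v, i}" by auto
    then have "x $ (\<sigma>, j) = \<alpha> \<sigma> + (b \<sigma> {v, i} + b \<sigma> (UNIV - {v, i}))"
      by (simp add: x_b complementary_edge[OF that(2,1)])
    ultimately show ?thesis by (simp add: t_def)
  qed
  \<comment> \<open>The edges on the right-hand side of \<open>arc\<close> avoid \<open>i\<close>, so they lie in the glued face.\<close>
  have "t (\<sigma>, v) + x $ (\<sigma>, q) = t (\<tau>, \<pi> v) + x $ (\<tau>, q')"
    if g: "G (\<sigma>, i) = (\<tau>, \<pi>)" and vi: "v \<noteq> i" and q: "{v, i} \<in> disjoint_edges q"
      and q': "{\<pi> v, \<pi> i} \<in> disjoint_edges q'" for \<sigma> i v \<tau> \<pi> q q'
  proof -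
    have "bij \<pi>" using G g unfolding oriented_triangulation_def by blast
    then have inj: "inj \<pi>" and img: "UNIV - {\<pi> v, \<pi> i} = \<pi> ` (UNIV - {v, i})"
      by (auto simp: bij_def image_set_diff)
    have b: "b \<tau> (\<pi> ` s) = b \<sigma> s" if "s \<in> vertex_pairs" "i \<notin> s" for s
      unfolding b_def using edge_mem_glued[where G = G, OF g _ that] by (intro sum.cong) auto
    have "card (UNIV - {v, i}) = 2"
      using vi by (simp add: card_Diff_subset) (simp add: UNIV_vert)
    then have "b \<tau> (UNIV - {\<pi> v, \<pi> i}) = b \<sigma> (UNIV - {v, i})"
      unfolding img by (intro b) (auto simp: vertex_pairs_def)
    moreover have "(\<Sum>w\<in>UNIV - {\<pi> v, \<pi> i}. b \<tau> {\<pi> v, w}) = (\<Sum>w\<in>UNIV - {v, i}. b \<sigma> {v, w})"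
    proof -
      have "b \<tau> {\<pi> v, \<pi> w} = b \<sigma> {v, w}" if "w \<in> UNIV - {v, i}" for w
        using b[of "{v, w}"] that vi by (auto simp: vertex_pairs_def)
      then show ?thesis
        unfolding img using inj by (subst sum.reindex) (auto intro: inj_on_subset)
    qed
    ultimately show ?thesis
      using arc[OF vi q] arc[OF _ q'] vi inj by (simp add: inj_eq)
  qed
  then show ?thesis
    unfolding haken_solution_def fst_conv snd_conv by (intro exI[of _ t]) blast
qed

lemma two_quad_type_solution_of_nonsmooth_maximum:
  fixes G :: "'a::finite gluing"
  assumes G: "oriented_triangulation G" and p: "p \<in> SAS G k"
    and max: "\<forall>x\<in>SAS G k. angle_volume x \<le> angle_volume p"
    and q: "p q\<^sub>0 = 1 \<or> p q\<^sub>0 = - 1"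
  shows "\<exists>y. two_quad_type_solution G y \<and> snd y q\<^sub>0 \<noteq> 0"
proof -
  define N where "N = {q. p q = 1 \<or> p q = - 1}"
  define c :: "real ^ 'a quad" where
    "c = (\<chi> q. if q \<in> N then 0 else ln \<bar>2 * sin (Arg (p q))\<bar>)"
  have c: "c \<bullet> u = (\<Sum>q\<in>-N. u $ q * ln \<bar>2 * sin (Arg (p q))\<bar>)" for u
  proof -
    have "c \<bullet> u = (\<Sum>q\<in>UNIV. if q \<in> - N then u $ q * ln \<bar>2 * sin (Arg (p q))\<bar> else 0)"
      unfolding inner_vec_def by (intro sum.cong) (auto simp: c_def)
    then show ?thesis by (simp add: sum.If_cases Compl_eq)
  qed
  have "\<forall>u\<in>deformations G. (\<Sum>q\<in>N. u $ q * ln \<bar>u $ q\<bar>) + c \<bullet> u = 0"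
    unfolding c unfolding N_def using critical_point[OF p max] by blast
  moreover have "q\<^sub>0 \<in> N" using q by (simp add: N_def)
  ultimately obtain x where x: "x \<in> (deformations G)\<^sup>\<bottom>" "x $ q\<^sub>0 \<noteq> 0" "card {q. x $ q \<noteq> 0} \<in> {1, 2}"
    using x_ln_abs_dependence[OF subspace_deformations] by blast
  moreover obtain t where "haken_solution G (t, \<lambda>q. x $ q)"
    using haken_solution_of_orthogonal[OF G x(1)] by blast
  ultimately show ?thesis
    unfolding two_quad_type_solution_def by (intro exI[of _ "(t, \<lambda>q. x $ q)"]) simp
qed

theorem theorem3p2:
  fixes G :: "'a::finite gluing"
    and k :: "'a tet_edge set \<Rightarrow> complex"
    and p :: "'a quad \<Rightarrow> complex"
  assumes "oriented_triangulation G"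
    and "\<forall>e\<in>edges G. k e \<in> sphere 0 1"
    and "(\<Prod>e\<in>edges G. k e) = 1"
    and "\<forall>v\<in>vertices G. (\<Prod>e\<in>edges G. k e ^ endpoint_count e v) = 1"
    and "p \<in> SAS G k"
    and "\<forall>x\<in>SAS G k. angle_volume x \<le> angle_volume p"
  shows "(smooth_point p \<longrightarrow>
            (\<exists>z :: 'a quad \<Rightarrow> complex.
              (\<forall>q q'. quad_arrow q q' \<longrightarrow> z q' * (1 - z q) = 1) \<and>
              (\<forall>e\<in>edges G. (\<Prod>q\<in>UNIV. z q ^ (2 * quad_index q e)) = (k e)\<^sup>2))) \<and>
         (\<forall>q\<^sub>0. p q\<^sub>0 = 1 \<or> p q\<^sub>0 = -1 \<longrightarrow>
            (\<exists>y. two_quad_type_solution G y \<and> snd y q\<^sub>0 \<noteq> 0))"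
  using thurston_solution_of_smooth_maximum[OF assms(1,5,6)]
    two_quad_type_solution_of_nonsmooth_maximum[OF assms(1,5,6)]
  by blast

end
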